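(* Let $G$ be a compactly presented locally compact group with compact symmetric generating set $S$, let $\delta$ be its Dehn function, and let $\mathcal{F}$ be an efficient set of words in $S$. Suppose that for some real number $\zeta>1$ the following holds: for every integer $k\ge 1$ there is a constant $a_k$ such that $\delta_{\mathcal{F}[k]}(n)\le a_k n^\zeta$ for all $n$. Then there exists a constant $C'$ such that $\delta(n)\le C'n^\zeta$ for all $n$.
   Context: Compact presentability means that there is an integer $\ell$ such that the abstract group $G$ has a presentation with generating set $S$ and relators of length $\le\ell$; fix such $(S,\ell)$. A relation (null-homotopic word) is a word in the letters of $S$ representing the trivial element of $G$; its area is the least $m$ such that it is, in the free group on $S$, a product of $\le m$ conjugates of relations of length $\le\ell$. The Dehn function is $\delta(n)=\sup\{\mathrm{area}(w): w\text{ a relation of length}\le n\}$. For words $w,w'$ in $S$, $w\equiv w'$ means they represent the same element of $G$, and $|w|_S$ is the length of the word $w$. For a set $\mathcal{F}$ of words in $S$, $\mathcal{F}[k]$ is the set of words obtained as the concatenation of $\le k$ words of $\mathcal{F}$. The restricted Dehn function $\delta_{\mathcal{F}}(n)$ is the supremum of the areas of the null-homotopic words of length $\le n$ belonging to $\mathcal{F}$ (with $\sup\emptyset=0$). The set $\mathcal{F}$ is efficient if there is a constant $C$ such that for every word $w$ in $S$ there exists $w'\in\mathcal{F}$ with $w'\equiv w$ and $|w'|_S\le C|w|_S$.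
   Formalization: The presentation bound ℓ is required either to be at least some ℓ₀ depending only on G and S, or to have a finite-valued Dehn function δ; for small ℓ, δ can be infinite although all hypotheses hold, so the claim for an arbitrary ℓ is false. *)

theory Defs
  imports "HOL-Analysis.Analysis" "HOL-Algebra.Algebra"
begin

definition locally_compact_group :: "('a, 'b) monoid_scheme \<Rightarrow> 'a topology \<Rightarrow> bool" where
  "locally_compact_group G T \<longleftrightarrow>
     group G \<and> topspace T = carrier G \<and>
     continuous_map (prod_topology T T) T (\<lambda>(x, y). x \<otimes>\<^bsub>G\<^esub> y) \<and>
     continuous_map T T (\<lambda>x. inv\<^bsub>G\<^esub> x) \<and>
     Hausdorff_space T \<and> locally_compact_space T"

text \<open>
  A word in \<open>S\<close> is a list of letters \<open>(s, b)\<close>, with \<open>(s, True)\<close> standing for the generator \<open>s\<close> and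
  \<open>(s, False)\<close> for its formal inverse, so that words represent the elements of the free group on the
  set \<open>S\<close>. If \<open>s\<close> and \<open>t\<close> in \<open>S\<close> are inverse to each other in \<open>G\<close>, then \<open>(s, True)(t, True)\<close> is a
  relation of length 2, but not the trivial element of the free group.
\<close>

type_synonym 'a word = "('a \<times> bool) list"

definition words :: "'a set \<Rightarrow> 'a word set" where
  "words S = lists (S \<times> UNIV)"

definition letter_val :: "('a, 'b) monoid_scheme \<Rightarrow> 'a \<times> bool \<Rightarrow> 'a" where
  "letter_val G x = (if snd x then fst x else inv\<^bsub>G\<^esub> (fst x))"

definition word_val :: "('a, 'b) monoid_scheme \<Rightarrow> 'a word \<Rightarrow> 'a" where
  "word_val G w = foldr (\<lambda>x y. letter_val G x \<otimes>\<^bsub>G\<^esub> y) w \<one>\<^bsub>G\<^esub>"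

inductive_set free_rel :: "'a set \<Rightarrow> ('a word \<times> 'a word) set" for S :: "'a set" where
  cancel: "u \<in> words S \<Longrightarrow> v \<in> words S \<Longrightarrow> s \<in> S \<Longrightarrow>
             (u @ [(s, b), (s, \<not> b)] @ v, u @ v) \<in> free_rel S"
| refl: "u \<in> words S \<Longrightarrow> (u, u) \<in> free_rel S"
| sym: "(u, v) \<in> free_rel S \<Longrightarrow> (v, u) \<in> free_rel S"
| trans: "(u, v) \<in> free_rel S \<Longrightarrow> (v, w) \<in> free_rel S \<Longrightarrow> (u, w) \<in> free_rel S"

definition free_class :: "'a set \<Rightarrow> 'a word \<Rightarrow> 'a word set" where
  "free_class S w = free_rel S `` {w}"

definition free_group :: "'a set \<Rightarrow> 'a word set monoid" where
  "free_group S =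
     \<lparr>carrier = words S // free_rel S,
      monoid.mult = (\<lambda>A B. \<Union>u\<in>A. \<Union>v\<in>B. free_class S (u @ v)),
      one = free_class S []\<rparr>"

definition normal_closure :: "('a, 'b) monoid_scheme \<Rightarrow> 'a set \<Rightarrow> 'a set" where
  "normal_closure G A = \<Inter>{N. N \<lhd> G \<and> A \<subseteq> N}"

definition relations :: "('a, 'b) monoid_scheme \<Rightarrow> 'a set \<Rightarrow> 'a word set" where
  "relations G S = {w \<in> words S. word_val G w = \<one>\<^bsub>G\<^esub>}"

text \<open>
  The classes of the relations form the kernel of the canonical homomorphism from the free group
  on \<open>S\<close> to \<open>G\<close>.
\<close>

definition is_presentation :: "('a, 'b) monoid_scheme \<Rightarrow> 'a set \<Rightarrow> 'a word set \<Rightarrow> bool" where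
  "is_presentation G S R \<longleftrightarrow>
     S \<subseteq> carrier G \<and> generate G S = carrier G \<and> R \<subseteq> words S \<and>
     free_class S ` relations G S = normal_closure (free_group S) (free_class S ` R)"

definition bounded_presentation :: "('a, 'b) monoid_scheme \<Rightarrow> 'a set \<Rightarrow> nat \<Rightarrow> bool" where
  "bounded_presentation G S l \<longleftrightarrow> (\<exists>R. is_presentation G S R \<and> (\<forall>r\<in>R. length r \<le> l))"

definition conjugates :: "('a, 'b) monoid_scheme \<Rightarrow> 'a set \<Rightarrow> 'a set" where
  "conjugates G A = {g \<otimes>\<^bsub>G\<^esub> a \<otimes>\<^bsub>G\<^esub> inv\<^bsub>G\<^esub> g | g a. g \<in> carrier G \<and> a \<in> A}"

text \<open>
  The set of relations of length at most \<open>l\<close> is closed under formal inversion, so there is no need to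
  allow inverses of relations below. The area is \<open>\<infinity>\<close> if there is no suitable product.
\<close>

definition area :: "('a, 'b) monoid_scheme \<Rightarrow> 'a set \<Rightarrow> nat \<Rightarrow> 'a word \<Rightarrow> enat" where
  "area G S l w =
     Inf {enat m | m. \<exists>xs. length xs \<le> m \<and>
       set xs \<subseteq> conjugates (free_group S) (free_class S ` {r \<in> relations G S. length r \<le> l}) \<and>
       free_class S w = foldr (\<otimes>\<^bsub>free_group S\<^esub>) xs \<one>\<^bsub>free_group S\<^esub>}"

definition restricted_dehn ::
    "('a, 'b) monoid_scheme \<Rightarrow> 'a set \<Rightarrow> nat \<Rightarrow> 'a word set \<Rightarrow> nat \<Rightarrow> enat" where
  "restricted_dehn G S l F n = Sup (area G S l ` {w \<in> relations G S. length w \<le> n \<and> w \<in> F})"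

definition dehn :: "('a, 'b) monoid_scheme \<Rightarrow> 'a set \<Rightarrow> nat \<Rightarrow> nat \<Rightarrow> enat" where
  "dehn G S l n = Sup (area G S l ` {w \<in> relations G S. length w \<le> n})"

definition concats :: "'a word set \<Rightarrow> nat \<Rightarrow> 'a word set" where
  "concats F k = {concat ws | ws. set ws \<subseteq> F \<and> length ws \<le> k}"

definition efficient :: "('a, 'b) monoid_scheme \<Rightarrow> 'a set \<Rightarrow> 'a word set \<Rightarrow> bool" where
  "efficient G S F \<longleftrightarrow>
     (\<exists>C::real. \<forall>w\<in>words S. \<exists>w'\<in>F.
        word_val G w' = word_val G w \<and> real (length w') \<le> C * real (length w))"

lemma words_append [simp]: "u @ v \<in> words S \<longleftrightarrow> u \<in> words S \<and> v \<in> words S"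
  by (auto simp: words_def)

lemma words_Nil [simp]: "[] \<in> words S"
  by (simp add: words_def)

lemma words_Cons [simp]: "x # w \<in> words S \<longleftrightarrow> fst x \<in> S \<and> w \<in> words S"
  by (cases x) (auto simp: words_def)

lemma free_rel_words: "(u, v) \<in> free_rel S \<Longrightarrow> u \<in> words S \<and> v \<in> words S"
  by (induction rule: free_rel.induct) auto

lemma equiv_free_rel: "equiv (words S) (free_rel S)"
proof (rule equivI)
  show "free_rel S \<subseteq> words S \<times> words S"
    using free_rel_words by fastforce
  show "refl_on (words S) (free_rel S)"
    using free_rel_words by (auto simp: refl_on_def intro: free_rel.refl)
  show "sym (free_rel S)"
    by (auto simp: sym_def dest: free_rel.sym)
  show "trans (free_rel S)"
    by (intro transI) (rule free_rel.trans)
qed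

lemma free_rel_ctxt:
  "(u, v) \<in> free_rel S \<Longrightarrow> p \<in> words S \<Longrightarrow> q \<in> words S \<Longrightarrow> (p @ u @ q, p @ v @ q) \<in> free_rel S"
proof (induction rule: free_rel.induct)
  case (cancel u v s b)
  then show ?case
    using free_rel.cancel[of "p @ u" S "v @ q" s b] by simp
next
  case (trans u v w)
  then show ?case
    using free_rel.trans by blast
qed (simp_all add: free_rel.refl free_rel.sym)

lemma free_rel_append:
  assumes "(u, u') \<in> free_rel S" "(v, v') \<in> free_rel S"
  shows "(u @ v, u' @ v') \<in> free_rel S"
proof -
  have "(u @ v, u' @ v) \<in> free_rel S"
    using free_rel_ctxt[OF assms(1), of "[]" v] free_rel_words[OF assms(2)] by simp
  moreover have "(u' @ v, u' @ v') \<in> free_rel S"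
    using free_rel_ctxt[OF assms(2), of u' "[]"] free_rel_words[OF assms(1)] by simp
  ultimately show ?thesis
    by (rule free_rel.trans)
qed

lemma free_class_eq_iff:
  "u \<in> words S \<Longrightarrow> v \<in> words S \<Longrightarrow> free_class S u = free_class S v \<longleftrightarrow> (u, v) \<in> free_rel S"
  unfolding free_class_def using eq_equiv_class_iff[OF equiv_free_rel] by blast

lemma free_class_mult:
  assumes "u \<in> words S" "v \<in> words S"
  shows "free_class S u \<otimes>\<^bsub>free_group S\<^esub> free_class S v = free_class S (u @ v)"
proof -
  have *: "free_class S (u' @ v') = free_class S (u @ v)"
    if "u' \<in> free_class S u" "v' \<in> free_class S v" for u' v'
  proof -
    have "(u, u') \<in> free_rel S" "(v, v') \<in> free_rel S"
      using that by (auto simp: free_class_def)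
    then have "(u' @ v', u @ v) \<in> free_rel S"
      by (intro free_rel.sym[OF free_rel_append])
    then show ?thesis
      using free_rel_words free_class_eq_iff by blast
  qed
  have ne: "free_class S u \<noteq> {}" "free_class S v \<noteq> {}"
    using assms by (auto simp: free_class_def intro: free_rel.refl)
  have "free_class S u \<otimes>\<^bsub>free_group S\<^esub> free_class S v =
      (\<Union>u'\<in>free_class S u. \<Union>v'\<in>free_class S v. free_class S (u @ v))"
    unfolding free_group_def by (simp add: * cong: SUP_cong)
  then show ?thesis
    using ne by simp
qed

lemma carrier_free_group: "carrier (free_group S) = free_class S ` words S"
  by (auto simp: free_group_def quotient_def free_class_def)

lemma one_free_group: "\<one>\<^bsub>free_group S\<^esub> = free_class S []"
  by (simp add: free_group_def)

definition word_inv :: "'a word \<Rightarrow> 'a word" where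
  "word_inv w = rev (map (\<lambda>(s, b). (s, \<not> b)) w)"

lemma word_inv_words [simp]: "word_inv w \<in> words S \<longleftrightarrow> w \<in> words S"
  by (induction w) (auto simp: word_inv_def)

lemma word_inv_left: "w \<in> words S \<Longrightarrow> (word_inv w @ w, []) \<in> free_rel S"
proof (induction w)
  case Nil
  then show ?case by (simp add: word_inv_def free_rel.refl)
next
  case (Cons x w)
  obtain s b where x: "x = (s, b)" by force
  have "(word_inv w @ [(s, \<not> b), (s, \<not> \<not> b)] @ w, word_inv w @ w) \<in> free_rel S"
    using Cons x by (intro free_rel.cancel) auto
  then have "(word_inv (x # w) @ x # w, word_inv w @ w) \<in> free_rel S"
    by (simp add: word_inv_def x)
  then show ?case
    using free_rel.trans[OF _ Cons.IH] Cons.prems by simp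
qed

lemma group_free_group: "group (free_group S)"
proof (rule groupI)
  show "\<exists>y\<in>carrier (free_group S). y \<otimes>\<^bsub>free_group S\<^esub> x = \<one>\<^bsub>free_group S\<^esub>"
    if x: "x \<in> carrier (free_group S)" for x
  proof -
    obtain w where w: "w \<in> words S" "x = free_class S w"
      using x by (auto simp: carrier_free_group)
    then have "free_class S (word_inv w) \<otimes>\<^bsub>free_group S\<^esub> x = \<one>\<^bsub>free_group S\<^esub>"
      by (simp add: free_class_mult one_free_group free_class_eq_iff word_inv_left)
    then show ?thesis
      using w by (auto simp: carrier_free_group)
  qed
qed (auto simp: carrier_free_group free_class_mult one_free_group)

end

theory Submission
  imports Defs
begin

text \<open>
  Gromov's trick: cut a relation of length \<open>n\<close> into \<open>k\<close> pieces of length about \<open>n / k\<close> and replace each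
  piece by an equivalent word of \<open>F\<close>, which is at most \<open>N\<close> times longer. This gives
  \<open>\<delta>(n) \<le> a\<^sub>k (N n)\<^sup>\<zeta> + k \<delta>((N + 1) \<lceil>n / k\<rceil>)\<close>. As \<open>\<zeta> > 1\<close>, the factor \<open>k (2 (N + 1) / k)\<^sup>\<zeta>\<close> is
  below \<open>1 / 2\<close> for large \<open>k\<close>, and the bound follows by induction on \<open>n\<close>, provided \<open>\<delta>\<close> is finite.

  For finiteness, Baire's theorem gives a word ball of some radius \<open>q\<close> with nonempty interior \<open>U\<close>, and
  finitely many translates of \<open>U\<close> cover the compact ball of radius \<open>n\<close>. Two relations of equal length
  at most \<open>n\<close> whose prefixes run through the same translates stay at distance at most \<open>2 q\<close> from each
  other, so their areas differ by at most \<open>n\<close> as soon as relations of length \<open>4 q + 2\<close> count as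
  area one. There are finitely many itineraries, and each single relation has finite area.
\<close>

subsection \<open>Words\<close>

lemma word_inv_Nil [simp]: "word_inv [] = []"
  by (simp add: word_inv_def)

lemma word_inv_append [simp]: "word_inv (u @ v) = word_inv v @ word_inv u"
  by (simp add: word_inv_def)

lemma word_inv_word_inv [simp]: "word_inv (word_inv w) = w"
  by (induction w) (auto simp: word_inv_def)

lemma length_word_inv [simp]: "length (word_inv w) = length w"
  by (simp add: word_inv_def)

lemma word_inv_right: "w \<in> words S \<Longrightarrow> (w @ word_inv w, []) \<in> free_rel S"
  using word_inv_left[of "word_inv w" S] by simp

lemma free_rel_cancel_word:
  assumes "p \<in> words S" "q \<in> words S" "w \<in> words S"
  shows "(p @ w @ word_inv w @ q, p @ q) \<in> free_rel S"
    and "(p @ word_inv w @ w @ q, p @ q) \<in> free_rel S"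
  using free_rel_ctxt[OF word_inv_right[OF assms(3)] assms(1,2)]
    free_rel_ctxt[OF word_inv_left[OF assms(3)] assms(1,2)] by simp_all

lemma free_rel_word_inv: "(u, v) \<in> free_rel S \<Longrightarrow> (word_inv u, word_inv v) \<in> free_rel S"
proof (induction rule: free_rel.induct)
  case (cancel u v s b)
  moreover have "word_inv [(s, b), (s, \<not> b)] = [(s, b), (s, \<not> b)]"
    by (simp add: word_inv_def)
  ultimately show ?case
    using free_rel.cancel[of "word_inv v" S "word_inv u" s b]
    by (simp only: word_inv_append word_inv_words append_assoc)
next
  case (trans u v w)
  then show ?case
    using free_rel.trans by blast
qed (simp_all add: free_rel.refl free_rel.sym)

lemma inv_free_class:
  assumes "w \<in> words S"
  shows "inv\<^bsub>free_group S\<^esub> (free_class S w) = free_class S (word_inv w)"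
proof -
  interpret F: group "free_group S"
    by (rule group_free_group)
  show ?thesis
    by (rule F.inv_equality)
      (use assms in \<open>auto simp: carrier_free_group free_class_mult one_free_group
        free_class_eq_iff word_inv_left\<close>)
qed

lemma words_take [simp]: "w \<in> words S \<Longrightarrow> take i w \<in> words S"
  and words_drop [simp]: "w \<in> words S \<Longrightarrow> drop i w \<in> words S"
  by (auto simp: words_def dest: in_set_takeD in_set_dropD)

lemma words_concat [simp]: "concat ws \<in> words S \<longleftrightarrow> set ws \<subseteq> words S"
  by (induction ws) auto

subsection \<open>Values of words\<close>

locale word_group = group G for G (structure) +
  fixes S :: "'a set"
  assumes S_carrier: "S \<subseteq> carrier G"
begin

lemma word_val_Nil [simp]: "word_val G [] = \<one>"
  by (simp add: word_val_def)

lemma word_val_Cons: "word_val G (x # w) = letter_val G x \<otimes> word_val G w"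
  by (simp add: word_val_def)

lemma letter_val_closed [simp]: "fst x \<in> S \<Longrightarrow> letter_val G x \<in> carrier G"
  using S_carrier by (auto simp: letter_val_def)

lemma word_val_closed [simp]: "w \<in> words S \<Longrightarrow> word_val G w \<in> carrier G"
  by (induction w) (auto simp: word_val_Cons)

lemma word_val_append [simp]:
  "u \<in> words S \<Longrightarrow> v \<in> words S \<Longrightarrow> word_val G (u @ v) = word_val G u \<otimes> word_val G v"
  by (induction u) (auto simp: word_val_Cons m_assoc)

lemma word_val_free_rel: "(u, v) \<in> free_rel S \<Longrightarrow> word_val G u = word_val G v"
proof (induction rule: free_rel.induct)
  case (cancel u v s b)
  have "s \<in> carrier G"
    using cancel S_carrier by auto
  then have "word_val G [(s, b), (s, \<not> b)] = \<one>"
    by (cases b) (simp_all add: word_val_Cons letter_val_def)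
  moreover have "[(s, b), (s, \<not> b)] \<in> words S"
    using cancel by simp
  ultimately show ?case
    using cancel by (simp del: append_Cons words_Cons)
qed auto

lemma word_val_word_inv [simp]: "w \<in> words S \<Longrightarrow> word_val G (word_inv w) = inv (word_val G w)"
  using word_val_free_rel[OF word_inv_left] by (intro inv_equality[symmetric]) auto

lemma relations_free_rel: "(u, v) \<in> free_rel S \<Longrightarrow> u \<in> relations G S \<longleftrightarrow> v \<in> relations G S"
  using word_val_free_rel[of u v] free_rel_words[of u v S] by (auto simp: relations_def)

lemma word_val_concat_cong:
  assumes "list_all2 (\<lambda>u v. u \<in> words S \<and> v \<in> words S \<and> word_val G u = word_val G v) us vs"
  shows "word_val G (concat us) = word_val G (concat vs)"
proof -
  have "set us \<subseteq> words S \<and> set vs \<subseteq> words S \<and> word_val G (concat us) = word_val G (concat vs)"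
    using assms by (induction rule: list_all2_induct) auto
  then show ?thesis
    by blast
qed

subsection \<open>Fillings\<close>

text \<open>Area at most \<open>m\<close>, expressed on words instead of classes of the free group:
  rule \<open>Free\<close> absorbs passing to the quotient. Inductions on fillings then replace
  manipulations of products of conjugates.\<close>

inductive filling :: "nat \<Rightarrow> nat \<Rightarrow> 'a word \<Rightarrow> bool" for l :: nat where
  Nil: "filling l 0 []"
| Conj: "filling l m w \<Longrightarrow> g \<in> words S \<Longrightarrow> r \<in> relations G S \<Longrightarrow> length r \<le> l \<Longrightarrow>
    filling l (Suc m) (g @ r @ word_inv g @ w)"
| Free: "filling l m w \<Longrightarrow> (w, w') \<in> free_rel S \<Longrightarrow> filling l m w'"

lemma filling_words: "filling l m w \<Longrightarrow> w \<in> words S"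
  by (induction rule: filling.induct) (auto simp: relations_def dest: free_rel_words)

lemma filling_mono:
  assumes "filling l m w" "m \<le> m'"
  shows "filling l m' w"
  using assms(2,1)
proof (induction rule: dec_induct)
  case (step m')
  \<comment> \<open>The empty word is a relation of length 0, so an empty conjugate pads the
    count.\<close>
  then show ?case
    using filling.Conj[of l m' w "[]" "[]"] by (simp add: relations_def)
qed

section \<open>Fillings and area\<close>

lemma filling_imp_products:
  assumes "filling l m w"
  shows "\<exists>xs. length xs = m \<and>
    set xs \<subseteq> conjugates (free_group S) (free_class S ` {r \<in> relations G S. length r \<le> l}) \<and>
    free_class S w = foldr (\<otimes>\<^bsub>free_group S\<^esub>) xs \<one>\<^bsub>free_group S\<^esub>"
  using assms
proof (induction rule: filling.induct)
  case Nil
  then show ?case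
    by (simp add: one_free_group)
next
  case (Conj m w g r)
  let ?c = "free_class S (g @ r @ word_inv g)"
  have r: "r \<in> words S"
    using Conj by (simp add: relations_def)
  have c: "?c = free_class S g \<otimes>\<^bsub>free_group S\<^esub> free_class S r \<otimes>\<^bsub>free_group S\<^esub> inv\<^bsub>free_group S\<^esub> free_class S g"
    using Conj r by (simp add: free_class_mult inv_free_class)
  have "free_class S g \<in> carrier (free_group S)"
    using Conj by (simp add: carrier_free_group)
  then have "?c \<in> conjugates (free_group S) (free_class S ` {r \<in> relations G S. length r \<le> l})"
    unfolding c conjugates_def using Conj by blast
  moreover have "free_class S (g @ r @ word_inv g @ w) = ?c \<otimes>\<^bsub>free_group S\<^esub> free_class S w"
    using Conj r filling_words[OF Conj.hyps(1)] by (simp add: free_class_mult)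
  moreover obtain xs where "length xs = m"
    "set xs \<subseteq> conjugates (free_group S) (free_class S ` {r \<in> relations G S. length r \<le> l})"
    "free_class S w = foldr (\<otimes>\<^bsub>free_group S\<^esub>) xs \<one>\<^bsub>free_group S\<^esub>"
    using Conj.IH by blast
  ultimately show ?case
    by (intro exI[of _ "?c # xs"]) auto
next
  case (Free m w w')
  then show ?case
    using free_class_eq_iff[of w S w'] free_rel_words[of w w' S] by simp
qed

lemma products_imp_filling:
  assumes "set xs \<subseteq> conjugates (free_group S) (free_class S ` {r \<in> relations G S. length r \<le> l})"
  shows "\<exists>u. filling l (length xs) u \<and>
    free_class S u = foldr (\<otimes>\<^bsub>free_group S\<^esub>) xs \<one>\<^bsub>free_group S\<^esub>"
  using assms
proof (induction xs)
  case Nil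
  then show ?case
    using filling.Nil by (auto simp: one_free_group)
next
  case (Cons x xs)
  then obtain u where u: "filling l (length xs) u"
    "free_class S u = foldr (\<otimes>\<^bsub>free_group S\<^esub>) xs \<one>\<^bsub>free_group S\<^esub>"
    by auto
  from Cons.prems obtain g r where gr: "g \<in> words S" "r \<in> relations G S" "length r \<le> l"
    "x = free_class S g \<otimes>\<^bsub>free_group S\<^esub> free_class S r \<otimes>\<^bsub>free_group S\<^esub> inv\<^bsub>free_group S\<^esub> free_class S g"
    by (auto simp: conjugates_def carrier_free_group)
  have "r \<in> words S" "u \<in> words S"
    using gr u filling_words by (auto simp: relations_def)
  then have "free_class S (g @ r @ word_inv g @ u) = x \<otimes>\<^bsub>free_group S\<^esub> free_class S u"
    using gr by (simp add: free_class_mult inv_free_class)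
  then show ?case
    using filling.Conj[OF u(1) gr(1-3)] u(2) by auto
qed

text \<open>An infimum of a nonempty set of extended naturals is attained, so a finite area comes
  from an actual product of conjugates. Such a product lifts to a filled word that is freely equal
  to \<open>w\<close>.\<close>

lemma area_le_iff:
  assumes "w \<in> words S"
  shows "area G S l w \<le> enat m \<longleftrightarrow> filling l m w"
proof -
  let ?A = "{enat m | m. \<exists>xs. length xs \<le> m \<and>
       set xs \<subseteq> conjugates (free_group S) (free_class S ` {r \<in> relations G S. length r \<le> l}) \<and>
       free_class S w = foldr (\<otimes>\<^bsub>free_group S\<^esub>) xs \<one>\<^bsub>free_group S\<^esub>}"
  show ?thesis
  proof
    assume "filling l m w"
    from filling_imp_products[OF this] have "enat m \<in> ?A"
      by blast
    then show "area G S l w \<le> enat m"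
      unfolding area_def by (rule Inf_lower)
  next
    assume le: "area G S l w \<le> enat m"
    have "?A \<noteq> {}"
    proof
      assume "?A = {}"
      then have "area G S l w = \<infinity>"
        unfolding area_def by (simp add: Inf_enat_def)
      then show False
        using le by simp
    qed
    then have "Inf ?A \<in> ?A"
      unfolding Inf_enat_def by (simp only: if_False) (rule LeastI_ex, blast)
    then obtain m' xs where m': "area G S l w = enat m'" "length xs \<le> m'"
      and xs: "set xs \<subseteq> conjugates (free_group S) (free_class S ` {r \<in> relations G S. length r \<le> l})"
        "free_class S w = foldr (\<otimes>\<^bsub>free_group S\<^esub>) xs \<one>\<^bsub>free_group S\<^esub>"
      unfolding area_def by blast
    obtain u where u: "filling l (length xs) u" "free_class S u = free_class S w"
      using products_imp_filling[OF xs(1)] xs(2) by auto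
    then have "(u, w) \<in> free_rel S"
      using assms filling_words free_class_eq_iff by blast
    then have "filling l (length xs) w"
      using u filling.Free by blast
    then show "filling l m w"
      by (rule filling_mono) (use le m' in auto)
  qed
qed

section \<open>Calculus of fillings\<close>

lemma filling_append:
  assumes "filling l m u" "filling l n v"
  shows "filling l (m + n) (u @ v)"
  using assms
proof (induction rule: filling.induct)
  case (Conj m w g r)
  then show ?case
    using filling.Conj[of l "m + n" "w @ v" g r] by simp
next
  case (Free m w w')
  then have "(w @ v, w' @ v) \<in> free_rel S"
    by (intro free_rel_append) (auto intro: free_rel.refl filling_words)
  then show ?case
    using Free filling.Free by blast
qed simp

lemma filling_conjugate:
  assumes "filling l m w" "g \<in> words S"
  shows "filling l m (g @ w @ word_inv g)"
  using assms
proof (induction rule: filling.induct)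
  case Nil
  then show ?case
    using filling.Free[OF filling.Nil free_rel.sym[OF word_inv_right]] by simp
next
  case (Conj m w h r)
  have w: "r \<in> words S" "w \<in> words S"
    using Conj filling_words by (auto simp: relations_def)
  \<comment> \<open>Freely, conjugating by \<open>g\<close> a product that starts with the conjugate
    of \<open>r\<close> by \<open>h\<close> gives the conjugate of \<open>r\<close> by
    \<open>g @ h\<close>, followed by the conjugate of the rest.\<close>
  have "filling l (Suc m) ((g @ h) @ r @ word_inv (g @ h) @ (g @ w @ word_inv g))"
    using Conj by (intro filling.Conj) auto
  moreover have "((g @ h @ r @ word_inv h) @ word_inv g @ g @ (w @ word_inv g),
      (g @ h @ r @ word_inv h) @ (w @ word_inv g)) \<in> free_rel S"
    using Conj w by (intro free_rel_cancel_word) auto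
  ultimately show ?case
    using filling.Free[of l "Suc m" "(g @ h) @ r @ word_inv (g @ h) @ (g @ w @ word_inv g)"] by simp
next
  case (Free m w w')
  then show ?case
    using filling.Free[OF Free.IH free_rel_ctxt] by simp
qed

lemma filling_relation:
  assumes "r \<in> relations G S" "length r \<le> l"
  shows "filling l 1 r"
  using filling.Conj[OF filling.Nil, of "[]" r l] assms by simp

lemma filling_word_inv:
  assumes "filling l m w"
  shows "filling l m (word_inv w)"
  using assms
proof (induction rule: filling.induct)
  case (Conj m w g r)
  have "filling l 1 (g @ word_inv r @ word_inv g)"
    using Conj by (intro filling_conjugate filling_relation) (auto simp: relations_def)
  then show ?case
    using filling_append[OF Conj.IH, of 1] by simp
next
  case (Free m w w')
  then show ?case
    using filling.Free free_rel_word_inv by blast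
qed (simp add: filling.Nil)

text \<open>Freely, p u q is the conjugate of u v^-1 by p, followed by p v q. Exchanging a subword
  thus costs the area of the loop formed by the old and the new subword.\<close>

lemma filling_replace:
  assumes "filling l m (p @ v @ q)" "filling l n (u @ word_inv v)"
  shows "filling l (m + n) (p @ u @ q)"
proof -
  have w: "p \<in> words S" "v \<in> words S" "q \<in> words S" "u \<in> words S"
    using assms filling_words by fastforce+
  have "filling l (n + m) ((p @ (u @ word_inv v) @ word_inv p) @ p @ v @ q)"
    using assms w by (intro filling_append filling_conjugate) auto
  moreover have 1: "((p @ u @ word_inv v) @ word_inv p @ p @ (v @ q), (p @ u @ word_inv v) @ (v @ q)) \<in> free_rel S"
    using w by (intro free_rel_cancel_word) auto
  moreover have 2: "((p @ u) @ word_inv v @ v @ q, (p @ u) @ q) \<in> free_rel S"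
    using w by (intro free_rel_cancel_word) auto
  ultimately show ?thesis
    using filling.Free[OF filling.Free[OF _ 1], of l "n + m" "(p @ u) @ q"] by (simp add: add.commute)
qed

text \<open>The pieces are exchanged from left to right. The prefix \<open>p\<close> is arbitrary so
  that the induction can store the pieces already exchanged in it.\<close>

lemma filling_concat_replace:
  assumes "list_all2 (\<lambda>u v. filling l n (u @ word_inv v)) us vs" "filling l m (p @ concat vs)"
  shows "filling l (m + length us * n) (p @ concat us)"
  using assms
proof (induction arbitrary: p m rule: list_all2_induct)
  case (Cons u us v vs)
  have "filling l (m + n) (p @ u @ concat vs)"
    using Cons filling_replace[of l m p v "concat vs" n u] by simp
  then have "filling l (m + n + length us * n) ((p @ u) @ concat us)"
    using Cons by (intro Cons.IH) simp
  then show ?case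
    by (simp add: add.assoc)
qed simp

text \<open>The classes of fillable words form a normal subgroup of the free group that contains the
  defining relators, hence also their normal closure, which consists of the classes of all
  relations. The argument gives no bound in terms of the length of \<open>w\<close>.\<close>

lemma relation_filling:
  assumes "bounded_presentation G S l" "w \<in> relations G S"
  shows "\<exists>m. filling l m w"
proof -
  interpret F: group "free_group S"
    by (rule group_free_group)
  obtain R where R: "R \<subseteq> words S" "\<And>r. r \<in> R \<Longrightarrow> length r \<le> l"
    "free_class S ` relations G S = normal_closure (free_group S) (free_class S ` R)"
    using assms(1) by (auto simp: bounded_presentation_def is_presentation_def)
  define N where "N = {free_class S u | u. \<exists>m. filling l m u}"
  have N_carrier: "N \<subseteq> carrier (free_group S)"
    using filling_words by (auto simp: N_def carrier_free_group)
  \<comment> \<open>Relators lie in their own normal closure, and the value in \<open>G\<close>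
    depends only on the free class, so they are relations and have fillings of size 1.\<close>
  have "R \<subseteq> relations G S"
  proof
    fix r assume r: "r \<in> R"
    then have "free_class S r \<in> free_class S ` relations G S"
      unfolding R(3) normal_closure_def by blast
    then obtain r' where "r' \<in> relations G S" "free_class S r = free_class S r'"
      by blast
    then show "r \<in> relations G S"
      using r R(1) relations_free_rel[of r r'] free_class_eq_iff[of r S r'] by (auto simp: relations_def)
  qed
  then have "free_class S ` R \<subseteq> N"
    using R(2) filling_relation unfolding N_def by blast
  moreover have "subgroup N (free_group S)"
  proof (rule F.subgroupI)
    show "N \<noteq> {}"
      unfolding N_def using filling.Nil by blast
    show "inv\<^bsub>free_group S\<^esub> a \<in> N" if a: "a \<in> N" for a
    proof -
      obtain u m where u: "a = free_class S u" "filling l m u"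
        using a unfolding N_def by blast
      then show ?thesis
        unfolding N_def using filling_word_inv[OF u(2)] inv_free_class[OF filling_words[OF u(2)]] by auto
    qed
    show "a \<otimes>\<^bsub>free_group S\<^esub> b \<in> N" if ab: "a \<in> N" "b \<in> N" for a b
    proof -
      obtain u m v n where u: "a = free_class S u" "filling l m u" "b = free_class S v" "filling l n v"
        using ab unfolding N_def by blast
      then have "a \<otimes>\<^bsub>free_group S\<^esub> b = free_class S (u @ v)"
        by (simp add: free_class_mult filling_words)
      then show ?thesis
        unfolding N_def using filling_append[OF u(2,4)] by blast
    qed
  qed (rule N_carrier)
  then have "N \<lhd> free_group S"
    unfolding F.normal_inv_iff
  proof (intro conjI ballI)
    fix x h assume "x \<in> carrier (free_group S)" "h \<in> N"
    then obtain g u m where g: "x = free_class S g" "g \<in> words S" "h = free_class S u" "filling l m u"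
      unfolding N_def carrier_free_group by blast
    then have "x \<otimes>\<^bsub>free_group S\<^esub> h \<otimes>\<^bsub>free_group S\<^esub> inv\<^bsub>free_group S\<^esub> x = free_class S (g @ u @ word_inv g)"
      using filling_words by (simp add: free_class_mult inv_free_class)
    then show "x \<otimes>\<^bsub>free_group S\<^esub> h \<otimes>\<^bsub>free_group S\<^esub> inv\<^bsub>free_group S\<^esub> x \<in> N"
      unfolding N_def using filling_conjugate g by blast
  qed
  ultimately have "normal_closure (free_group S) (free_class S ` R) \<subseteq> N"
    by (auto simp: normal_closure_def)
  then have "free_class S w \<in> N"
    using R(3) assms(2) by blast
  then obtain u m where "filling l m u" "free_class S w = free_class S u"
    unfolding N_def by blast
  then have "(u, w) \<in> free_rel S"
    using assms(2) filling_words free_class_eq_iff[of u S w] by (auto simp: relations_def)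
  then show ?thesis
    using \<open>filling l m u\<close> filling.Free by blast
qed

lemma dehn_le_iff:
  "dehn G S l n \<le> enat m \<longleftrightarrow> (\<forall>w \<in> relations G S. length w \<le> n \<longrightarrow> filling l m w)"
proof -
  have "dehn G S l n \<le> enat m \<longleftrightarrow> (\<forall>w \<in> relations G S. length w \<le> n \<longrightarrow> area G S l w \<le> enat m)"
    unfolding dehn_def by (auto simp: Sup_le_iff)
  then show ?thesis
    using area_le_iff by (auto simp: relations_def)
qed

end

subsection \<open>Word balls and finiteness of the Dehn function\<close>

lemma (in group) inv_mult_cancel:
  assumes "x \<in> carrier G" "y \<in> carrier G"
  shows "inv x \<otimes> (x \<otimes> y) = y" "x \<otimes> (inv x \<otimes> y) = y"
  using assms by (simp_all flip: m_assoc)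

section \<open>Covering compact sets by translates\<close>

lemma continuous_map_left_mult:
  assumes "locally_compact_group G T" "g \<in> carrier G"
  shows "continuous_map T T (\<lambda>z. g \<otimes>\<^bsub>G\<^esub> z)"
proof -
  have "continuous_map T (prod_topology T T) (\<lambda>z. (g, z))"
    using assms by (auto simp: continuous_map_pairwise o_def locally_compact_group_def)
  moreover have "continuous_map (prod_topology T T) T (\<lambda>(x, y). x \<otimes>\<^bsub>G\<^esub> y)"
    using assms by (simp add: locally_compact_group_def)
  ultimately have "continuous_map T T ((\<lambda>(x, y). x \<otimes>\<^bsub>G\<^esub> y) \<circ> (\<lambda>z. (g, z)))"
    by (rule continuous_map_compose)
  then show ?thesis
    by (simp add: o_def)
qed

lemma compactin_finite_translates:
  assumes G: "locally_compact_group G T" and K: "compactin T K" and U: "openin T U" "U \<noteq> {}"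
  shows "\<exists>Y. finite Y \<and> (\<forall>z\<in>K. \<exists>g\<in>Y. g \<in> carrier G \<and> inv\<^bsub>G\<^esub> g \<otimes>\<^bsub>G\<^esub> z \<in> U)"
proof -
  interpret group G
    using G by (simp add: locally_compact_group_def)
  have top: "topspace T = carrier G"
    using G by (simp add: locally_compact_group_def)
  \<comment> \<open>This is the translate of \<open>U\<close> by \<open>g\<close>, written as a
    preimage so that continuity of left multiplication makes it open.\<close>
  define V where "V g = {z \<in> topspace T. inv\<^bsub>G\<^esub> g \<otimes>\<^bsub>G\<^esub> z \<in> U}" for g
  obtain x where x: "x \<in> U" "x \<in> carrier G"
    using U openin_subset top by blast
  have "openin T (V g)" if "g \<in> carrier G" for g
    unfolding V_def
    by (intro openin_continuous_map_preimage[OF continuous_map_left_mult[OF G]] U) (use that in auto)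
  moreover have "K \<subseteq> \<Union> (V ` carrier G)"
  proof
    fix z assume "z \<in> K"
    then have z: "z \<in> carrier G"
      using K compactin_subset_topspace top by blast
    \<comment> \<open>The translate by z x^-1 moves the chosen point \<open>x\<close> of
      \<open>U\<close> to \<open>z\<close>.\<close>
    then have "z \<in> V (z \<otimes>\<^bsub>G\<^esub> inv\<^bsub>G\<^esub> x)"
      using x by (simp add: V_def top inv_mult_group m_assoc)
    then show "z \<in> \<Union> (V ` carrier G)"
      using x z by auto
  qed
  ultimately obtain \<F> where \<F>: "finite \<F>" "\<F> \<subseteq> V ` carrier G" "K \<subseteq> \<Union> \<F>"
    using compactinD[OF K, of "V ` carrier G"] by auto
  then obtain Y where Y: "finite Y" "Y \<subseteq> carrier G" "\<F> = V ` Y"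
    by (meson finite_subset_image)
  then show ?thesis
    using \<F>(3) unfolding V_def by (intro exI[of _ Y]) blast
qed

section \<open>Compactness and interior of word balls\<close>

context word_group
begin

definition word_ball :: "nat \<Rightarrow> 'a set" where
  "word_ball n = word_val G ` {w \<in> words S. length w \<le> n}"

lemma word_ball_inv_mult:
  assumes "x \<in> word_ball m" "y \<in> word_ball n"
  shows "inv x \<otimes> y \<in> word_ball (m + n)"
proof -
  obtain u v where u: "u \<in> words S" "length u \<le> m" "x = word_val G u"
    and v: "v \<in> words S" "length v \<le> n" "y = word_val G v"
    using assms by (auto simp: word_ball_def)
  then have "inv x \<otimes> y = word_val G (word_inv u @ v)"
    by simp
  then show ?thesis
    unfolding word_ball_def using u v by (intro image_eqI[where x = "word_inv u @ v"]) auto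
qed

text \<open>This recursion yields compactness of the balls: each one is the union of the previous
  ball and a continuous image of a compact product. Inverses of \<open>S\<close> occur because
  letters may be formal inverses.\<close>

lemma word_ball_Suc:
  "word_ball (Suc n) = word_ball n \<union> (\<lambda>(x, y). x \<otimes> y) ` ((S \<union> m_inv G ` S) \<times> word_ball n)"
  (is "?L = ?R")
proof (intro equalityI subsetI)
  fix z assume "z \<in> ?L"
  then obtain w where w: "w \<in> words S" "length w \<le> Suc n" "z = word_val G w"
    by (auto simp: word_ball_def)
  show "z \<in> ?R"
  proof (cases w)
    case Nil
    then have "z \<in> word_ball n"
      using w unfolding word_ball_def by (intro image_eqI[of _ _ "[]"]) auto
    then show ?thesis
      by blast
  next
    case (Cons x v)
    then have "letter_val G x \<in> S \<union> m_inv G ` S" "word_val G v \<in> word_ball n"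
      using w by (auto simp: letter_val_def word_ball_def)
    then show ?thesis
      using Cons w by (auto simp: word_val_Cons)
  qed
next
  have letters: "S \<union> m_inv G ` S \<subseteq> letter_val G ` {x. fst x \<in> S}"
  proof
    fix s assume "s \<in> S \<union> m_inv G ` S"
    then obtain t where "t \<in> S" "s = t \<or> s = inv t"
      by blast
    then show "s \<in> letter_val G ` {x. fst x \<in> S}"
      using image_eqI[of s "letter_val G" "(t, True)" "{x. fst x \<in> S}"]
        image_eqI[of s "letter_val G" "(t, False)" "{x. fst x \<in> S}"]
      by (auto simp: letter_val_def)
  qed
  fix z assume "z \<in> ?R"
  then consider "z \<in> word_ball n"
    | s v where "s \<in> S \<union> m_inv G ` S" "v \<in> words S" "length v \<le> n" "z = s \<otimes> word_val G v"
    by (auto simp: word_ball_def)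
  then show "z \<in> ?L"
  proof cases
    case (2 s v)
    then obtain x where "fst x \<in> S" "s = letter_val G x"
      using letters by blast
    with 2 show ?thesis
      unfolding word_ball_def by (intro image_eqI[of _ _ "x # v"]) (auto simp: word_val_Cons)
  qed (auto simp: word_ball_def)
qed

lemma Union_word_ball:
  assumes "generate G S = carrier G"
  shows "(\<Union>n. word_ball n) = carrier G"
proof
  show "(\<Union>n. word_ball n) \<subseteq> carrier G"
    by (auto simp: word_ball_def)
  have "\<exists>w\<in>words S. g = word_val G w" if "g \<in> generate G S" for g
    using that
  proof (induction rule: generate.induct)
    case one
    then show ?case
      by (intro bexI[of _ "[]"]) auto
  next
    case (incl h)
    then show ?case
      using S_carrier by (intro bexI[of _ "[(h, True)]"]) (auto simp: word_val_Cons letter_val_def)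
  next
    case (inv h)
    then show ?case
      using S_carrier by (intro bexI[of _ "[(h, False)]"]) (auto simp: word_val_Cons letter_val_def)
  next
    case (eng h1 h2)
    then obtain u v where "u \<in> words S" "v \<in> words S" "h1 = word_val G u" "h2 = word_val G v"
      by blast
    then show ?case
      by (intro bexI[of _ "u @ v"]) auto
  qed
  then show "carrier G \<subseteq> (\<Union>n. word_ball n)"
    unfolding assms word_ball_def by blast
qed

lemma compactin_word_ball:
  assumes "locally_compact_group G T" "compactin T S"
  shows "compactin T (word_ball n)"
proof (induction n)
  case 0
  have "word_ball 0 = {\<one>}"
    by (auto simp: word_ball_def)
  then show ?case
    using assms by (simp add: locally_compact_group_def)
next
  case (Suc n)
  have "compactin T (m_inv G ` S)"
    using assms image_compactin by (fastforce simp: locally_compact_group_def)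
  then have "compactin (prod_topology T T) ((S \<union> m_inv G ` S) \<times> word_ball n)"
    using assms(2) Suc by (simp add: compactin_Times compactin_Un)
  then have "compactin T ((\<lambda>(x, y). x \<otimes> y) ` ((S \<union> m_inv G ` S) \<times> word_ball n))"
    using assms(1) image_compactin by (fastforce simp: locally_compact_group_def)
  then show ?case
    using Suc by (simp add: word_ball_Suc compactin_Un)
qed

text \<open>The balls are compact, hence closed, and countably many of them cover \<open>G\<close>.
  If all had empty interior, so would their union by Baire's theorem; but the union is the whole
  nonempty space.\<close>

lemma word_ball_has_interior:
  assumes G: "locally_compact_group G T" and S: "compactin T S" and gen: "generate G S = carrier G"
  shows "\<exists>q. T interior_of word_ball q \<noteq> {}"
proof (rule ccontr)
  assume *: "\<nexists>q. T interior_of word_ball q \<noteq> {}"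
  have T: "topspace T = carrier G" "Hausdorff_space T" "locally_compact_space T"
    using G by (auto simp: locally_compact_group_def)
  have "regular_space T"
    using T locally_compact_Hausdorff_imp_regular_space by blast
  then have "T interior_of \<Union> (range word_ball) = {}"
    using * T compactin_word_ball[OF G S]
    by (intro Baire_category_alt) (auto intro: compactin_imp_closedin)
  moreover have "T interior_of \<Union> (range word_ball) = topspace T"
    unfolding Union_word_ball[OF gen] T(1)[symmetric] by simp
  ultimately show False
    using T(1) by blast
qed

text \<open>
  The words \<open>h i\<close> join corresponding prefixes of \<open>w\<close> and \<open>w'\<close>. They cut the region between the two
  loops into one quadrilateral of perimeter at most \<open>2 * q + 2\<close> for each letter.
\<close>

lemma filling_transport:
  assumes w: "w \<in> relations G S" "filling l m w"
    and w': "w' \<in> relations G S" "length w' = length w"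
    and close: "\<And>i. i \<le> length w \<Longrightarrow>
      inv (word_val G (take i w)) \<otimes> word_val G (take i w') \<in> word_ball q"
    and l: "2 * q + 2 \<le> l"
  shows "filling l (m + length w) w'"
proof -
  define n where "n = length w"
  have ww: "w \<in> words S" "w' \<in> words S"
    using w w' by (auto simp: relations_def)
  \<comment> \<open>At \<open>i = 0\<close> and \<open>i = n\<close> both prefixes have value 1, and
    the connecting word is chosen empty there, so that the telescoping product below leaves no
    remainder at the ends.\<close>
  have "\<exists>u. i \<le> n \<longrightarrow> u \<in> words S \<and> length u \<le> q \<and> (i = 0 \<or> i = n \<longrightarrow> u = []) \<and>
      word_val G u = inv (word_val G (take i w)) \<otimes> word_val G (take i w')" for i
  proof (cases "i = 0 \<or> i = n")
    case True
    then have "inv (word_val G (take i w)) \<otimes> word_val G (take i w') = \<one>"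
      using w w' by (auto simp: relations_def n_def)
    then show ?thesis
      by (intro exI[of _ "[]"]) simp
  next
    case False
    then show ?thesis
      using close[of i] unfolding word_ball_def n_def image_iff by (metis (mono_tags, lifting) mem_Collect_eq)
  qed
  then obtain h where h': "\<forall>i. i \<le> n \<longrightarrow> h i \<in> words S \<and> length (h i) \<le> q \<and> (i = 0 \<or> i = n \<longrightarrow> h i = []) \<and>
      word_val G (h i) = inv (word_val G (take i w)) \<otimes> word_val G (take i w')"
    by metis
  then have h: "\<And>i. i \<le> n \<Longrightarrow> h i \<in> words S" "\<And>i. i \<le> n \<Longrightarrow> length (h i) \<le> q"
    "\<And>i. i \<le> n \<Longrightarrow> word_val G (h i) = inv (word_val G (take i w)) \<otimes> word_val G (take i w')"
    by simp_all
  have h_ends: "h 0 = []" "h n = []"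
    using h'[rule_format, of 0] h'[rule_format, of n] by simp_all
  \<comment> \<open>The detour from the \<open>i\<close>-th to the next vertex of \<open>w'\<close>:
    across to \<open>w\<close>, along one letter of \<open>w\<close>, and back. Its value is that of
    the letter \<open>w' ! i\<close>.\<close>
  define f where "f i = word_inv (h i) @ [w ! i] @ h (Suc i)" for i
  have letters: "[w ! i] \<in> words S" "[w' ! i] \<in> words S" if "i < n" for i
    using that ww w'(2) nth_mem[of i w] nth_mem[of i w'] by (auto simp: words_def n_def)
  \<comment> \<open>In the product of the detours each \<open>h i\<close> cancels against its
    inverse in the next factor. For \<open>j = n\<close> what remains is \<open>w\<close>, so the
    product of all detours inherits the filling of \<open>w\<close>.\<close>
  have "(concat (map f [0..<j]), take j w @ h j) \<in> free_rel S" if "j \<le> n" for j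
    using that
  proof (induction j)
    case 0
    then show ?case
      using h_ends by (simp add: free_rel.refl)
  next
    case (Suc j)
    then have j: "j < n" "f j \<in> words S"
      using h letters by (auto simp: f_def)
    have "(concat (map f [0..<j]) @ f j, (take j w @ h j) @ f j) \<in> free_rel S"
      using Suc j by (intro free_rel_append free_rel.refl) auto
    moreover have "(take j w @ h j @ word_inv (h j) @ ([w ! j] @ h (Suc j)), take j w @ ([w ! j] @ h (Suc j)))
        \<in> free_rel S"
      using ww h letters j Suc.prems by (intro free_rel_cancel_word) auto
    ultimately show ?case
      using free_rel.trans[of "concat (map f [0..<j]) @ f j" "(take j w @ h j) @ f j"] j(1)
      by (simp add: f_def[of j] take_Suc_conv_app_nth n_def)
  qed
  from this[of n] have "(w, concat (map f [0..<n])) \<in> free_rel S"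
    using h_ends by (simp add: n_def free_rel.sym)
  then have "filling l m (concat (map f [0..<n]))"
    using w filling.Free by blast
  \<comment> \<open>One quadrilateral: two letters and two connecting words of length at most
    \<open>q\<close>, so its perimeter is at most \<open>2 * q + 2\<close> and it counts as area
    one.\<close>
  moreover have "filling l 1 ([w' ! i] @ word_inv (f i))" if i: "i < n" for i
  proof (rule filling_relation)
    let ?a = "word_val G (take i w)" and ?x = "word_val G [w ! i]"
      and ?a' = "word_val G (take i w')" and ?x' = "word_val G [w' ! i]"
    have c: "?a \<in> carrier G" "?x \<in> carrier G" "?a' \<in> carrier G" "?x' \<in> carrier G"
      using ww letters[OF i] by (auto simp del: words_Cons)
    have S: "word_val G (take (Suc i) w) = ?a \<otimes> ?x" "word_val G (take (Suc i) w') = ?a' \<otimes> ?x'"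
      using i ww w'(2) letters[OF i]
      by (simp_all add: take_Suc_conv_app_nth n_def del: words_Cons)
    have hs: "h i \<in> words S" "h (Suc i) \<in> words S"
      using h i by auto
    have "word_val G (f i) = inv (inv ?a \<otimes> ?a') \<otimes> (?x \<otimes> (inv (?a \<otimes> ?x) \<otimes> (?a' \<otimes> ?x')))"
      using hs h(3)[of i] h(3)[of "Suc i"] i letters[OF i] unfolding f_def S
      by (simp del: words_Cons append_Cons)
    also have "\<dots> = ?x'"
      using c by (simp add: inv_mult_group m_assoc inv_mult_cancel)
    finally have "word_val G (f i) = ?x'" .
    moreover have "f i \<in> words S"
      using hs letters[OF i] by (simp add: f_def)
    ultimately show "[w' ! i] @ word_inv (f i) \<in> relations G S"
      using letters[OF i] c by (simp add: relations_def del: words_Cons append_Cons)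
    show "length ([w' ! i] @ word_inv (f i)) \<le> l"
      using h(2)[of i] h(2)[of "Suc i"] i l by (simp add: f_def)
  qed
  then have "list_all2 (\<lambda>u v. filling l 1 (u @ word_inv v)) (map (\<lambda>i. [w' ! i]) [0..<n]) (map f [0..<n])"
    by (auto simp: list_all2_conv_all_nth)
  ultimately have "filling l (m + n * 1) ([] @ concat (map (\<lambda>i. [w' ! i]) [0..<n]))"
    using filling_concat_replace[of l 1 "map (\<lambda>i. [w' ! i]) [0..<n]" "map f [0..<n]" m "[]"] by simp
  moreover have "concat (map (\<lambda>i. [w' ! i]) [0..<n]) = w'"
    using w'(2) map_nth[of w'] by (simp add: n_def)
  ultimately show ?thesis
    by (simp add: n_def)
qed

lemma dehn_finite:
  assumes G: "locally_compact_group G T" and S: "compactin T S"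
    and q: "T interior_of word_ball q \<noteq> {}"
    and l: "bounded_presentation G S l" "4 * q + 2 \<le> l"
  shows "dehn G S l n < \<infinity>"
proof -
  define U where "U = T interior_of word_ball q"
  obtain Y where Y: "finite Y" "\<forall>z\<in>word_ball n. \<exists>g\<in>Y. g \<in> carrier G \<and> inv g \<otimes> z \<in> U"
    using compactin_finite_translates[OF G compactin_word_ball[OF G S], of U n] q
    by (auto simp: U_def)
  then obtain idx where idx: "\<And>z. z \<in> word_ball n \<Longrightarrow> idx z \<in> Y"
    "\<And>z. z \<in> word_ball n \<Longrightarrow> idx z \<in> carrier G" "\<And>z. z \<in> word_ball n \<Longrightarrow> inv (idx z) \<otimes> z \<in> U"
    by metis
  define R where "R = {w \<in> relations G S. length w \<le> n}"
  define sig where "sig w = map (\<lambda>i. idx (word_val G (take i w))) [0..<Suc (length w)]" for w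
  \<comment> \<open>If \<open>sig w = sig w'\<close>, then corresponding prefixes of \<open>w\<close> and \<open>w'\<close> lie in a common translate of \<open>U\<close>.\<close>
  have ball: "word_val G (take i w) \<in> word_ball n" if "w \<in> R" for w i
    using that by (auto simp: word_ball_def R_def relations_def)
  have "sig ` R \<subseteq> {xs. set xs \<subseteq> Y \<and> length xs \<le> Suc n}"
    using ball idx(1) by (auto simp: sig_def R_def simp del: upt_Suc)
  then have fin: "finite (sig ` R)"
    using finite_lists_length_le[OF Y(1)] finite_subset by blast
  obtain c where c: "\<And>w. w \<in> R \<Longrightarrow> filling l (c w) w"
    using relation_filling[OF l(1)] unfolding R_def by (metis mem_Collect_eq)
  \<comment> \<open>Only one representative relation per itinerary enters, so the maximum is over a
    finite set even when \<open>R\<close> is infinite.\<close>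
  define M where "M = Max ((\<lambda>s. c (inv_into R sig s)) ` sig ` R)"
  have "filling l (M + n) w'" if w': "w' \<in> R" for w'
  proof -
    define w where "w = inv_into R sig (sig w')"
    have w: "w \<in> R" "sig w = sig w'"
      using w' by (auto simp: w_def inv_into_into f_inv_into_f)
    have "c w \<le> M"
      unfolding M_def w_def using fin w' by (intro Max_ge) auto
    have len: "length w' = length w"
      using arg_cong[OF w(2), of length] by (simp add: sig_def)
    \<comment> \<open>Both prefixes, shifted back by the same translate, lie in the ball of radius
      \<open>q\<close>. The distance bound \<open>q + q\<close> makes the perimeter
      \<open>2 * (q + q) + 2\<close>, whence the requirement
      \<open>4 * q + 2 \<le> l\<close>.\<close>
    have "inv (word_val G (take i w)) \<otimes> word_val G (take i w') \<in> word_ball (q + q)"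
      if i: "i \<le> length w" for i
    proof -
      let ?a = "word_val G (take i w)" and ?b = "word_val G (take i w')"
      have "sig w ! i = sig w' ! i"
        using w by simp
      then have eq: "idx ?a = idx ?b"
        using i len by (simp add: sig_def del: upt_Suc)
      have ab: "?a \<in> word_ball n" "?b \<in> word_ball n"
        using ball w w' by auto
      then have "inv (idx ?a) \<otimes> ?a \<in> word_ball q" "inv (idx ?a) \<otimes> ?b \<in> word_ball q"
        using idx(3)[OF ab(1)] idx(3)[OF ab(2)] interior_of_subset[of T "word_ball q"]
        unfolding eq U_def by auto
      then have "inv (inv (idx ?a) \<otimes> ?a) \<otimes> (inv (idx ?a) \<otimes> ?b) \<in> word_ball (q + q)"
        by (rule word_ball_inv_mult)
      moreover have "?a \<in> carrier G" "?b \<in> carrier G" "idx ?a \<in> carrier G"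
        using ab idx(2) w w' by (auto simp: R_def relations_def)
      then have "inv (inv (idx ?a) \<otimes> ?a) \<otimes> (inv (idx ?a) \<otimes> ?b) = inv ?a \<otimes> ?b"
        by (simp add: inv_mult_group m_assoc inv_mult_cancel)
      ultimately show ?thesis
        by simp
    qed
    then have "filling l (c w + length w) w'"
      using w w' len l c by (intro filling_transport[where q = "q + q"]) (auto simp: R_def)
    then show ?thesis
      by (rule filling_mono) (use \<open>c w \<le> M\<close> w in \<open>auto simp: R_def\<close>)
  qed
  then have "dehn G S l n \<le> enat (M + n)"
    unfolding dehn_le_iff by (auto simp: R_def)
  then show ?thesis
    using enat_ord_simps(4) le_less_trans by blast
qed

end

subsection \<open>Gromov's trick\<close>

lemma powr_bound_of_recurrence:
  fixes d :: "nat \<Rightarrow> nat" and \<zeta> :: real and C :: nat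
  assumes \<zeta>: "1 < \<zeta>" and "mono d" and "d 0 = 0" and C: "1 \<le> C"
    and rec: "\<And>k. 1 \<le> k \<Longrightarrow>
      \<exists>a::real. \<forall>n. real (d n) \<le> a * real n powr \<zeta> + real k * real (d (C * ((n + k - 1) div k)))"
  shows "\<exists>C'::real. \<forall>n. real (d n) \<le> C' * real n powr \<zeta>"
proof -
  \<comment> \<open>The 2 comes from n + k - 1 \<le> 2 n for k \<le> n, so the recursive argument is
    at most \<open>b / real k * real n\<close>.\<close>
  define b where "b = 2 * real C"
  have b: "b > 0"
    using C by (simp add: b_def)
  \<comment> \<open>The expression equals k (b / k)^\<zeta>, the factor by which the recursive term
    multiplies the inductive bound. The exponent 1 - \<zeta> is negative, so large \<open>k\<close>
    push it below 1/2.\<close>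
  have "((\<lambda>k. b powr \<zeta> * real k powr (1 - \<zeta>)) \<longlongrightarrow> b powr \<zeta> * 0) sequentially"
    using \<zeta> by (intro tendsto_mult tendsto_const tendsto_neg_powr filterlim_real_sequentially) simp
  then have "\<forall>\<^sub>F k in sequentially. b powr \<zeta> * real k powr (1 - \<zeta>) < 1 / 2"
    by (intro order_tendstoD(2)[where y = 0]) simp_all
  then obtain k where k: "k \<ge> 1" "b powr \<zeta> * real k powr (1 - \<zeta>) < 1 / 2"
    using eventually_happens'[OF sequentially_bot eventually_conj[OF _ eventually_ge_at_top[of 1]]] by blast
  have k_half: "real k * (b / real k) powr \<zeta> < 1 / 2"
    using k b by (simp add: powr_divide powr_diff field_simps)
  \<comment> \<open>This makes the recursive argument strictly smaller than \<open>n\<close>, as the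
    induction requires.\<close>
  have "b < real k"
  proof (rule ccontr)
    assume "\<not> b < real k"
    then have "1 \<le> (b / real k) powr \<zeta>"
      using k \<zeta> by (intro ge_one_powr_ge_zero) auto
    then have "1 * 1 \<le> real k * (b / real k) powr \<zeta>"
      using k by (intro mult_mono) auto
    then show False
      using k_half by simp
  qed
  obtain a where a: "\<And>n. real (d n) \<le> a * real n powr \<zeta> + real k * real (d (C * ((n + k - 1) div k)))"
    using rec[OF k(1)] by blast
  \<comment> \<open>The first entry settles 1 \<le> n < k by monotonicity. The second gives a \<le>
    M / 2, which leaves the other half of \<open>M\<close> for the recursive term.\<close>
  define M where "M = max (real (d k)) (2 * \<bar>a\<bar>)"
  have M: "real (d k) \<le> M" "a \<le> M / 2" "0 \<le> M"
    by (auto simp: M_def)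
  have "real (d n) \<le> M * real n powr \<zeta>" for n
  proof (induction n rule: less_induct)
    case (less n)
    consider "n = 0" | "1 \<le> n" "n < k" | "k \<le> n"
      by linarith
    then show ?case
    proof cases
      case 1
      then show ?thesis
        using \<open>d 0 = 0\<close> by simp
    next
      case 2
      have "real (d n) \<le> real (d k)"
        using \<open>mono d\<close> 2 by (simp add: monoD)
      also have "\<dots> \<le> M * 1"
        using M by simp
      also have "\<dots> \<le> M * real n powr \<zeta>"
        using 2 \<zeta> M by (intro mult_left_mono ge_one_powr_ge_zero) auto
      finally show ?thesis .
    next
      case 3
      define p where "p = C * ((n + k - 1) div k)"
      have "real ((n + k - 1) div k) \<le> real (n + k - 1) / real k"
        by (rule of_nat_div_le_of_nat)
      also have "\<dots> \<le> 2 * real n / real k"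
        using 3 k by (intro divide_right_mono) auto
      finally have "real C * real ((n + k - 1) div k) \<le> real C * (2 * real n / real k)"
        by (intro mult_left_mono) auto
      then have p: "real p \<le> b / real k * real n"
        by (simp add: p_def b_def mult_ac)
      also have "\<dots> < 1 * real n"
        using \<open>b < real k\<close> 3 k by (intro mult_strict_right_mono) auto
      finally have "p < n"
        by simp
      have "real (d p) \<le> M * real p powr \<zeta>"
        by (rule less.IH[OF \<open>p < n\<close>])
      also have "\<dots> \<le> M * (b / real k * real n) powr \<zeta>"
        using p M \<zeta> by (intro mult_left_mono powr_mono2) auto
      also have "\<dots> = M * (b / real k) powr \<zeta> * real n powr \<zeta>"
        by (simp only: powr_mult mult.assoc)
      finally have "real k * real (d p) \<le> real k * (M * (b / real k) powr \<zeta> * real n powr \<zeta>)"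
        by (intro mult_left_mono) auto
      also have "\<dots> = real k * (b / real k) powr \<zeta> * (M * real n powr \<zeta>)"
        by simp
      also have "\<dots> \<le> 1 / 2 * (M * real n powr \<zeta>)"
        using k_half M by (intro mult_right_mono) auto
      finally have "real k * real (d p) \<le> 1 / 2 * (M * real n powr \<zeta>)" .
      moreover have "a * real n powr \<zeta> \<le> M / 2 * real n powr \<zeta>"
        using M by (intro mult_right_mono) auto
      ultimately show ?thesis
        using a[of n] by (simp add: p_def)
    qed
  qed
  then show ?thesis
    by blast
qed

lemma concat_map_blocks: "concat (map (\<lambda>i. take m (drop (i * m) w)) [0..<k]) = take (k * m) w"
proof (induction k)
  case (Suc k)
  then show ?case
    using take_add[of "k * m" m w] by (simp add: add.commute)
qed simp

section \<open>From subdivision to the bound on the Dehn function\<close>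

context word_group
begin

text \<open>The word made of the substitutes from \<open>F\<close> is a relation filled by
  \<open>long\<close>. Exchanging each of the \<open>k\<close> substitutes for its original piece
  costs \<open>d\<close>, since piece and substitute bound a loop covered by
  \<open>short\<close>.\<close>

lemma filling_subdivide:
  assumes F: "F \<subseteq> words S"
    and eff: "\<And>u. u \<in> words S \<Longrightarrow> \<exists>u'\<in>F. word_val G u' = word_val G u \<and> length u' \<le> N * length u"
    and w: "w \<in> relations G S" "length w \<le> n" and k: "1 \<le> k"
    and short: "\<And>r. r \<in> relations G S \<Longrightarrow> length r \<le> (N + 1) * ((n + k - 1) div k) \<Longrightarrow> filling l d r"
    and long: "\<And>r. r \<in> relations G S \<Longrightarrow> r \<in> concats F k \<Longrightarrow> length r \<le> N * n \<Longrightarrow> filling l b r"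
  shows "filling l (b + k * d) w"
proof -
  obtain f where f: "\<And>u. u \<in> words S \<Longrightarrow> f u \<in> F"
    "\<And>u. u \<in> words S \<Longrightarrow> word_val G (f u) = word_val G u"
    "\<And>u. u \<in> words S \<Longrightarrow> length (f u) \<le> N * length u"
    using eff by metis
  \<comment> \<open>The ceiling of n / k, so that \<open>k\<close> blocks of length \<open>m\<close>
    exhaust \<open>w\<close>; the last blocks may be shorter or empty.\<close>
  define m where "m = (n + k - 1) div k"
  define us where "us = map (\<lambda>i. take m (drop (i * m) w)) [0..<k]"
  have ww: "w \<in> words S"
    using w by (simp add: relations_def)
  have us: "set us \<subseteq> words S"
    using ww by (auto simp: us_def)
  have fus: "f u \<in> words S" if "u \<in> words S" for u
    using f(1)[OF that] F by blast
  have "n + k - 1 < k * Suc m"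
    using k dividend_less_div_times[of k "n + k - 1"] by (simp add: m_def mult.commute)
  then have "length w \<le> k * m"
    using w k by simp
  then have concat_us: "concat us = w"
    unfolding us_def concat_map_blocks by simp
  \<comment> \<open>The lengths of the pieces add up to that of \<open>w\<close>, so the bound is
    \<open>N * n\<close> with no loss from rounding up the block length.\<close>
  have "length (concat (map f us)) \<le> N * length (concat us)"
    using us f(3) by (induction us) (auto simp: distrib_left intro!: add_mono)
  also have "\<dots> \<le> N * n"
    using w(2) concat_us by simp
  finally have len: "length (concat (map f us)) \<le> N * n" .
  have val: "word_val G (concat (map f us)) = word_val G (concat us)"
    using us f(2) fus by (intro word_val_concat_cong) (auto simp: list_all2_conv_all_nth subset_iff)
  have "concat (map f us) \<in> concats F k"
    using f(1) us unfolding concats_def us_def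
    by (intro CollectI exI[of _ "map f us"]) (auto simp: us_def)
  then have "filling l b (concat (map f us))"
    using len val us fus w concat_us by (intro long) (auto simp: relations_def)
  moreover have "filling l d (u @ word_inv (f u))" if "u \<in> set us" for u
  proof (rule short)
    have u: "u \<in> words S" "length u \<le> m"
      using that us by (auto simp: us_def)
    then show "u @ word_inv (f u) \<in> relations G S"
      using fus f(2) by (simp add: relations_def)
    have "length (f u) \<le> N * m"
      using f(3)[OF u(1)] u(2) mult_le_mono2 le_trans by blast
    then show "length (u @ word_inv (f u)) \<le> (N + 1) * ((n + k - 1) div k)"
      using u(2) unfolding m_def[symmetric] by simp
  qed
  then have "list_all2 (\<lambda>u v. filling l d (u @ word_inv v)) us (map f us)"
    by (auto simp: list_all2_conv_all_nth)
  ultimately have "filling l (b + length us * d) ([] @ concat us)"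
    by (intro filling_concat_replace) auto
  then show ?thesis
    using concat_us by (simp add: us_def)
qed

lemma dehn_powr_bound:
  fixes \<zeta> :: real
  assumes fin: "\<And>n. dehn G S l n < \<infinity>"
    and F: "F \<subseteq> words S" and eff: "efficient G S F" and \<zeta>: "1 < \<zeta>"
    and restr: "\<And>k. 1 \<le> k \<Longrightarrow> \<exists>a::real. \<forall>n.
      ereal_of_enat (restricted_dehn G S l (concats F k) n) \<le> ereal (a * real n powr \<zeta>)"
  shows "\<exists>C'::real. \<forall>n. ereal_of_enat (dehn G S l n) \<le> ereal (C' * real n powr \<zeta>)"
proof -
  obtain C :: real where C: "\<And>w. w \<in> words S \<Longrightarrow>
      \<exists>w'\<in>F. word_val G w' = word_val G w \<and> real (length w') \<le> C * real (length w)"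
    using eff by (auto simp: efficient_def)
  define N where "N = nat \<lceil>C\<rceil>"
  have N: "\<exists>u'\<in>F. word_val G u' = word_val G u \<and> length u' \<le> N * length u" if u: "u \<in> words S" for u
  proof -
    obtain u' where u': "u' \<in> F" "word_val G u' = word_val G u" "real (length u') \<le> C * real (length u)"
      using C[OF u] by blast
    note u'(3)
    also have "C * real (length u) \<le> real N * real (length u)"
      by (intro mult_right_mono) (auto simp: N_def real_nat_ceiling_ge)
    finally have "length u' \<le> N * length u"
      by (metis of_nat_le_iff of_nat_mult)
    then show ?thesis
      using u' by blast
  qed
  define d where "d n = the_enat (dehn G S l n)" for n
  have d: "dehn G S l n = enat (d n)" for n
    using fin[of n] by (auto simp: d_def)
  have d_filling: "filling l (d n) w" if "w \<in> relations G S" "length w \<le> n" for w n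
    using dehn_le_iff[of l n "d n"] that d by simp
  have d_le: "d n \<le> m" if "\<And>w. w \<in> relations G S \<Longrightarrow> length w \<le> n \<Longrightarrow> filling l m w" for n m
    using dehn_le_iff[of l n m] that d by simp
  have "mono d"
    by (intro monoI d_le d_filling) auto
  moreover have "d 0 = 0"
    using d_le[of 0 0] filling.Nil by simp
  moreover have "\<exists>a::real. \<forall>n. real (d n) \<le>
      a * real n powr \<zeta> + real k * real (d ((N + 1) * ((n + k - 1) div k)))" if k: "1 \<le> k" for k
  proof -
    obtain a :: real where a: "\<And>n.
        ereal_of_enat (restricted_dehn G S l (concats F k) n) \<le> ereal (a * real n powr \<zeta>)"
      using restr[OF k] by blast
    have "real (d n) \<le>
      a * real N powr \<zeta> * real n powr \<zeta> + real k * real (d ((N + 1) * ((n + k - 1) div k)))" for n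
    proof -
      \<comment> \<open>The restricted Dehn function is bounded by a real number here, hence its
        value is a natural number.\<close>
      obtain b where b: "restricted_dehn G S l (concats F k) (N * n) = enat b"
        using a[of "N * n"] by (cases "restricted_dehn G S l (concats F k) (N * n)") auto
      have "filling l b r" if r: "r \<in> relations G S" "r \<in> concats F k" "length r \<le> N * n" for r
      proof -
        have "area G S l r \<le> restricted_dehn G S l (concats F k) (N * n)"
          unfolding restricted_dehn_def using r by (intro Sup_upper) auto
        then show ?thesis
          using r b area_le_iff[of r l b] by (simp add: relations_def)
      qed
      then have "d n \<le> b + k * d ((N + 1) * ((n + k - 1) div k))"
        by (intro d_le filling_subdivide[OF F N _ _ k] d_filling)
      then have "real (d n) \<le> real b + real k * real (d ((N + 1) * ((n + k - 1) div k)))"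
        by (metis of_nat_add of_nat_le_iff of_nat_mult)
      moreover have "real b \<le> a * real N powr \<zeta> * real n powr \<zeta>"
        using a[of "N * n"] b by (simp add: powr_mult)
      ultimately show ?thesis
        by linarith
    qed
    then show ?thesis
      by blast
  qed
  ultimately obtain C' :: real where "\<And>n. real (d n) \<le> C' * real n powr \<zeta>"
    using powr_bound_of_recurrence[OF \<zeta>, of d "N + 1"] by auto
  then show ?thesis
    using d by auto
qed

end

text \<open>The recurrence carries no information where the Dehn function is infinite. Finiteness is
  therefore either assumed or obtained from \<open>dehn_finite\<close>, whose threshold
  \<open>4 * q + 2\<close> serves as \<open>l0\<close>, with \<open>q\<close> the radius of a word
  ball with nonempty interior.\<close>

theorem proposition4p3:
  fixes G :: "('a, 'b) monoid_scheme" and T :: "'a topology" and S :: "'a set"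
  assumes "locally_compact_group G T"
    and "compactin T S"
    and "\<forall>s\<in>S. inv\<^bsub>G\<^esub> s \<in> S"
    and "generate G S = carrier G"
    and "\<exists>l. bounded_presentation G S l"
  shows "\<exists>l0. \<forall>l. bounded_presentation G S l \<longrightarrow> (l0 \<le> l \<or> (\<forall>n. dehn G S l n < \<infinity>)) \<longrightarrow>
    (\<forall>F (\<zeta>::real).
       F \<subseteq> words S \<longrightarrow> efficient G S F \<longrightarrow> 1 < \<zeta> \<longrightarrow>
       (\<forall>k\<ge>1. \<exists>a::real. \<forall>n.
          ereal_of_enat (restricted_dehn G S l (concats F k) n) \<le> ereal (a * real n powr \<zeta>)) \<longrightarrow>
       (\<exists>C'::real. \<forall>n. ereal_of_enat (dehn G S l n) \<le> ereal (C' * real n powr \<zeta>)))"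
proof -
  have "S \<subseteq> carrier G"
    using assms(1) compactin_subset_topspace[OF assms(2)] by (simp add: locally_compact_group_def)
  then interpret word_group G S
    using assms(1) by (simp add: word_group_def word_group_axioms_def locally_compact_group_def)
  obtain q where q: "T interior_of word_ball q \<noteq> {}"
    using word_ball_has_interior assms by blast
  show ?thesis
  proof (intro exI[of _ "4 * q + 2"] allI impI)
    fix l F and \<zeta> :: real
    assume l: "bounded_presentation G S l" "4 * q + 2 \<le> l \<or> (\<forall>n. dehn G S l n < \<infinity>)"
      and F: "F \<subseteq> words S" "efficient G S F" "1 < \<zeta>" "\<forall>k\<ge>1. \<exists>a::real. \<forall>n.
          ereal_of_enat (restricted_dehn G S l (concats F k) n) \<le> ereal (a * real n powr \<zeta>)"
    have "\<And>n. dehn G S l n < \<infinity>"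
      using l dehn_finite[OF assms(1,2) q] by blast
    then show "\<exists>C'::real. \<forall>n. ereal_of_enat (dehn G S l n) \<le> ereal (C' * real n powr \<zeta>)"
      using F by (intro dehn_powr_bound) auto
  qed
qed

end
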